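(* Let $U,V\in\mathbb{Q}$ satisfy $3U^{3}-V^{3}=2$ with $U\neq 1$. Let $N=\frac{U^{3}-1}{8}\in\mathbb{Q}$, and for any $q\in\mathbb{Q}$ with $q\neq 0$ define $$d=Nq^{2},\qquad r=N^{2}q^{3},\qquad k=r^{2}-d^{3}=N^{3}(N-1)q^{6}.$$ Then the elliptic curve $$E_{k}:\quad y^{2}=x^{3}+k$$ contains the six rational points $$(d,\pm r),\qquad (Ud,\pm 3r),\qquad (Vd,\pm 5r),$$ whose $y$-coordinates form an arithmetic progression of length six (namely $-5r,-3r,-r,r,3r,5r$).
   Context: For $k\in\mathbb{Q}$, $E_k$ denotes the Mordell curve $y^2=x^3+k$ over $\mathbb{Q}$. An arithmetic progression of length six means six distinct rational numbers, in order, with constant difference. *)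

theory Defs
  imports "HOL-Analysis.Derivative"
begin

definition mordell_form :: "'a::field \<Rightarrow> 'a \<Rightarrow> 'a \<Rightarrow> 'a \<Rightarrow> 'a" where
  "mordell_form k X Y Z = Y^2 * Z - X^3 - k * Z^3"

text \<open>The Jacobian criterion, meant for \<open>F\<close> a homogeneous polynomial function.\<close>

definition smooth_plane_curve :: "(complex \<Rightarrow> complex \<Rightarrow> complex \<Rightarrow> complex) \<Rightarrow> bool" where
  "smooth_plane_curve F \<longleftrightarrow>
     (\<nexists>X Y Z. (X, Y, Z) \<noteq> (0, 0, 0) \<and> F X Y Z = 0 \<and>
        deriv (\<lambda>t. F t Y Z) X = 0 \<and>
        deriv (\<lambda>t. F X t Z) Y = 0 \<and>
        deriv (\<lambda>t. F X Y t) Z = 0)"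

text \<open>
  The projective closure of \<open>y\<^sup>2 = x\<^sup>3 + k\<close> is a plane cubic with the rational point
  \<open>(0 : 1 : 0)\<close>, so it is an elliptic curve over the rationals exactly when it is geometrically
  smooth. Smoothness may be tested over the complex numbers, an algebraically closed extension
  of the rationals.
\<close>

definition mordell_elliptic :: "rat \<Rightarrow> bool" where
  "mordell_elliptic k \<longleftrightarrow>
     mordell_form k 0 1 0 = 0 \<and> smooth_plane_curve (mordell_form (of_rat k))"

text \<open>The affine rational points, that is, all rational points except \<open>(0 : 1 : 0)\<close>.\<close>

definition mordell_points :: "rat \<Rightarrow> (rat \<times> rat) set" where
  "mordell_points k = {(x, y). y^2 = x^3 + k}"

definition arith_prog :: "nat \<Rightarrow> rat list \<Rightarrow> bool" where
  "arith_prog n xs \<longleftrightarrow>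
     length xs = n \<and> distinct xs \<and>
     (\<exists>D. \<forall>i. Suc i < n \<longrightarrow> xs ! Suc i - xs ! i = D)"

end

theory Submission
  imports Defs "HOL-Computational_Algebra.Primes"
begin

text \<open>
  The curve is built backwards from the three points. A point \<open>(u d, m r)\<close> lies on
  \<open>y\<^sup>2 = x\<^sup>3 + k\<close> with \<open>k = r\<^sup>2 - d\<^sup>3\<close> as soon as \<open>(m\<^sup>2 - 1) r\<^sup>2 = (u\<^sup>3 - 1) d\<^sup>3\<close>. Since
  \<open>d\<close> and \<open>r\<close> are chosen so that \<open>r\<^sup>2 = N d\<^sup>3\<close>, this only asks for \<open>u\<^sup>3 - 1 = (m\<^sup>2 - 1) N\<close>. For
  \<open>m = 1, 3, 5\<close> the conditions are \<open>u\<^sup>3 = 1\<close>, \<open>U\<^sup>3 - 1 = 8 N\<close> and \<open>V\<^sup>3 - 1 = 24 N\<close>: the second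
  defines \<open>N\<close>, and the third is then the equation \<open>3 U\<^sup>3 - V\<^sup>3 = 2\<close>.

  What remains is that nothing degenerates. The six values \<open>\<plusminus>r, \<plusminus>3r, \<plusminus>5r\<close> are distinct because
  \<open>r \<noteq> 0\<close>, and the curve is smooth because \<open>k \<noteq> 0\<close>. The first needs \<open>N \<noteq> 0\<close>, that is
  \<open>U\<^sup>3 \<noteq> 1\<close>, which over the rationals means \<open>U \<noteq> 1\<close>. The second needs in addition \<open>N \<noteq> 1\<close>, that
  is \<open>U\<^sup>3 \<noteq> 9\<close>, which holds because 9 is not the cube of a rational number.
\<close>

text \<open>
  In \<open>a\<^sup>3 = 9 b\<^sup>3\<close> the exponent of the prime 3 is divisible by 3 on the left, but leaves
  remainder 2 on the right.
\<close>

lemma rat_cube_neq_9: "x^3 \<noteq> 9" for x :: rat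
proof
  assume x: "x^3 = 9"
  obtain a b :: int where ab: "x = of_int a / of_int b" "b > 0"
    by (metis quotient_of_denom_pos quotient_of_div surj_pair)
  have "(of_int (a^3) :: rat) = of_int (3^2 * b^3)"
    using x ab by (simp add: field_simps)
  then have eq: "a^3 = 3^2 * b^3"
    by (simp only: of_int_eq_iff)
  have "a \<noteq> 0"
    using eq ab(2) by auto
  have p: "prime_elem (3::int)"
    by (intro prime_imp_prime_elem) simp
  have "3 * multiplicity 3 a = multiplicity 3 (a^3)"
    using p \<open>a \<noteq> 0\<close> by (simp add: prime_elem_multiplicity_power_distrib)
  also have "\<dots> = multiplicity 3 ((3::int)^2) + multiplicity 3 (b^3)"
    unfolding eq using p ab(2) by (subst prime_elem_multiplicity_mult_distrib) auto
  also have "\<dots> = 2 + 3 * multiplicity 3 b"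
    using p ab(2) prime_elem_multiplicity_power_distrib[OF p, of 3 2]
    by (simp add: prime_elem_multiplicity_power_distrib prime_elem_def)
  finally show False
    by presburger
qed

lemma rat_cube_eq_1_iff: "x^3 = 1 \<longleftrightarrow> x = 1" for x :: rat
proof
  assume "x^3 = 1"
  \<comment> \<open>The cofactor \<open>x\<^sup>2 + x + 1\<close> of \<open>x - 1\<close> is positive: complete the square.\<close>
  then have "(x - 1) * ((x + 1/2)^2 + 3/4) = 0"
    by (simp add: field_simps power2_eq_square power3_eq_cube)
  moreover have "(x + 1/2)^2 + 3/4 > 0"
    by (intro add_nonneg_pos) simp_all
  ultimately show "x = 1"
    by simp
qed simp

text \<open>
  The three partial derivatives at \<open>(X, Y, Z)\<close> are \<open>-3 X\<^sup>2\<close>, \<open>2 Y Z\<close> and \<open>Y\<^sup>2 - 3 k Z\<^sup>2\<close>. If the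
  first two vanish, then \<open>X = 0\<close> and one of \<open>Y\<close>, \<open>Z\<close> is zero; the last one then forces the
  other to be zero, because \<open>k \<noteq> 0\<close>.
\<close>

lemma smooth_mordell_form:
  fixes k :: complex
  assumes "k \<noteq> 0"
  shows "smooth_plane_curve (mordell_form k)"
proof -
  have "(X, Y, Z) = (0, 0, 0)"
    if "deriv (\<lambda>t. mordell_form k t Y Z) X = 0"
      and "deriv (\<lambda>t. mordell_form k X t Z) Y = 0"
      and "deriv (\<lambda>t. mordell_form k X Y t) Z = 0" for X Y Z
  proof -
    have "((\<lambda>t. mordell_form k t Y Z) has_field_derivative - 3 * X^2) (at X)"
      unfolding mordell_form_def by (auto intro!: derivative_eq_intros)
    then have "X = 0"
      using that(1) by (simp add: DERIV_imp_deriv)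
    have "((\<lambda>t. mordell_form k X t Z) has_field_derivative 2 * Y * Z) (at Y)"
      unfolding mordell_form_def by (auto intro!: derivative_eq_intros)
    then have "Y = 0 \<or> Z = 0"
      using that(2) by (simp add: DERIV_imp_deriv)
    moreover have "((\<lambda>t. mordell_form k X Y t) has_field_derivative Y^2 - 3 * k * Z^2) (at Z)"
      unfolding mordell_form_def by (auto intro!: derivative_eq_intros)
    then have "Y^2 - 3 * k * Z^2 = 0"
      using that(3) by (simp add: DERIV_imp_deriv)
    ultimately show ?thesis
      using \<open>X = 0\<close> assms by auto
  qed
  then show ?thesis
    unfolding smooth_plane_curve_def by blast
qed

lemma mordell_ellipticI: "mordell_elliptic k" if "k \<noteq> 0"
  using that by (simp add: mordell_elliptic_def smooth_mordell_form) (simp add: mordell_form_def)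

lemma scaled_mordell_pointI:
  assumes "r^2 = N * d^3" and "k = r^2 - d^3" and "u^3 - 1 = (m^2 - 1) * N"
  shows "(u * d, m * r) \<in> mordell_points k"
proof -
  have "(m * r)^2 - r^2 = (m^2 - 1) * N * d^3"
    using assms(1) by (simp add: algebra_simps)
  also have "\<dots> = (u * d)^3 - d^3"
    unfolding assms(3)[symmetric] by (simp add: algebra_simps)
  finally show ?thesis
    using assms(2) by (simp add: mordell_points_def)
qed

theorem theorem2p4:
  fixes U V N q d r k :: rat
  assumes "3 * U^3 - V^3 = 2"
    and "U \<noteq> 1"
    and "N = (U^3 - 1) / 8"
    and "q \<noteq> 0"
    and "d = N * q^2"
    and "r = N^2 * q^3"
    and "k = r^2 - d^3"
  shows "k = N^3 * (N - 1) * q^6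
    \<and> mordell_elliptic k
    \<and> (let P = [(V * d, - (5 * r)), (U * d, - (3 * r)), (d, - r),
                (d, r), (U * d, 3 * r), (V * d, 5 * r)]
       in set P \<subseteq> mordell_points k
          \<and> map snd P = [- (5 * r), - (3 * r), - r, r, 3 * r, 5 * r]
          \<and> arith_prog 6 (map snd P))"
proof -
  have k: "k = N^3 * (N - 1) * q^6"
    unfolding assms(5-7) by algebra
  have "N \<noteq> 0" "N \<noteq> 1"
    using assms(2,3) rat_cube_eq_1_iff[of U] rat_cube_neq_9[of U] by auto
  then have "r \<noteq> 0" "k \<noteq> 0"
    using assms(4,6) k by auto
  have rd: "r^2 = N * d^3"
    unfolding assms(5,6) by algebra
  have UV: "U^3 - 1 = 8 * N" "V^3 - 1 = 24 * N"
    using assms(1,3) by auto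
  note point = scaled_mordell_pointI[OF rd assms(7)]
  have "(d, r) \<in> mordell_points k" "(d, - r) \<in> mordell_points k"
    using point[of 1 1] point[of 1 "-1"] by simp_all
  moreover have "(U * d, 3 * r) \<in> mordell_points k" "(U * d, - (3 * r)) \<in> mordell_points k"
    using point[of U 3] point[of U "-3"] UV by simp_all
  moreover have "(V * d, 5 * r) \<in> mordell_points k" "(V * d, - (5 * r)) \<in> mordell_points k"
    using point[of V 5] point[of V "-5"] UV by simp_all
  moreover have "arith_prog 6 [- (5 * r), - (3 * r), - r, r, 3 * r, 5 * r]"
    unfolding arith_prog_def
  proof (intro conjI exI allI impI)
    fix i :: nat
    assume "Suc i < 6"
    then have "i \<in> {0, 1, 2, 3, 4}"
      by auto
    then show "[- (5 * r), - (3 * r), - r, r, 3 * r, 5 * r] ! Suc i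
        - [- (5 * r), - (3 * r), - r, r, 3 * r, 5 * r] ! i = 2 * r"
      by (elim insertE) simp_all
  qed (use \<open>r \<noteq> 0\<close> in simp_all)
  ultimately show ?thesis
    using k mordell_ellipticI[OF \<open>k \<noteq> 0\<close>] by (simp add: Let_def)
qed

end
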